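(* Let $p:\mathbb{N}\to[0,1]$ be such that $\lim_{n\to\infty}n\,p(n)=0$. For $G\in G(n,p(n))$ write $\gamma_k=\gamma_k(\mathcal{P}_G)$. Then $$\lim_{n\to\infty}\mathbb{P}(\gamma_k=0\text{ for all }k\geq 1)=1.$$
   Context: $G(n,p)$ is the Erdős–Rényi model of random graphs on vertex set $[n]$, where each of the $\binom n2$ possible edges is present independently with probability $p=p(n)$. For a finite simple graph $G=([n],E)$, the symmetric edge polytope is $\mathcal{P}_G=\mathrm{conv}(\pm(e_i-e_j) : ij\in E)\subset\mathbb{R}^n$ (if $E=\emptyset$, it is understood to be the single point $0$, with $\gamma$-vector $(1)$). It is a lattice polytope; let $d=\dim\mathcal{P}_G$. Its $h^*$-vector $(h_0^*,\dots,h_d^* )$ is defined by $|m\mathcal{P}_G\cap\mathbb{Z}^n|=\sum_{j=0}^d h_j^*\binom{m+d-j}{d}$ for all integers $m\ge 0$. It is known that $\mathcal{P}_G$ is reflexive, so $h_j^*=h_{d-j}^*$, and the $\gamma$-vector $(\gamma_0(\mathcal{P}_G),\dots,\gamma_{\lfloor d/2\rfloor}(\mathcal{P}_G))$ is defined by $\sum_{i=0}^{\lfloor d/2\rfloor}\gamma_i t^i(1+t)^{d-2i}=\sum_{j=0}^d h_j^*t^j$. We set $\gamma_i(\mathcal{P}_G)=0$ for $i>\lfloor d/2\rfloor$. *)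

theory Defs
  imports
    "HOL-Probability.Probability"
    "HOL-Library.Function_Algebras"
    "HOL-Computational_Algebra.Polynomial"
begin

text \<open>
  The ambient dimension of the polytopes below varies with \<open>n\<close>, so \<open>\<real>\<^sup>n\<close> is realised as the
  space of functions \<open>nat \<Rightarrow> real\<close> vanishing outside \<open>{1..n}\<close>. The pointwise vector space
  structure on functions makes the library notions of convex hull, affine hull and dimension
  available.
\<close>

instantiation "fun" :: (type, real_vector) real_vector
begin

definition scaleR_fun :: "real \<Rightarrow> ('a \<Rightarrow> 'b) \<Rightarrow> 'a \<Rightarrow> 'b" where
  "scaleR_fun c f = (\<lambda>x. c *\<^sub>R f x)"

instance
  by standard (simp_all add: scaleR_fun_def fun_eq_iff scaleR_add_right scaleR_add_left)

end

definition unit_vec :: "nat \<Rightarrow> nat \<Rightarrow> real" where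
  "unit_vec i = (\<lambda>k. if k = i then 1 else 0)"

text \<open>A simple graph on the vertex set \<open>{1..n}\<close> is given by its edge set, a subset of \<open>all_edges n\<close>.\<close>

definition all_edges :: "nat \<Rightarrow> nat set set" where
  "all_edges n = {e. e \<subseteq> {1..n} \<and> card e = 2}"

definition erdos_renyi :: "nat \<Rightarrow> real \<Rightarrow> nat set set pmf" where
  "erdos_renyi n q =
     map_pmf (\<lambda>f. {e \<in> all_edges n. f e}) (Pi_pmf (all_edges n) False (\<lambda>_. bernoulli_pmf q))"

text \<open>Both signs \<open>\<plusminus>(e\<^sub>i - e\<^sub>j)\<close> occur, because \<open>{i, j} = {j, i}\<close>.\<close>

definition sym_edge_polytope :: "nat set set \<Rightarrow> (nat \<Rightarrow> real) set" where
  "sym_edge_polytope E =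
     (if E = {} then {0} else convex hull {unit_vec i - unit_vec j | i j. {i, j} \<in> E})"

text \<open>
  The dimension is that of the linear subspace parallel to the affine hull
  (the library's \<open>aff_dim\<close> is restricted to Euclidean spaces).
\<close>

definition polytope_dim :: "(nat \<Rightarrow> real) set \<Rightarrow> nat" where
  "polytope_dim P = dim {x - y | x y. x \<in> affine hull P \<and> y \<in> affine hull P}"

definition lattice_points :: "(nat \<Rightarrow> real) set \<Rightarrow> (nat \<Rightarrow> real) set" where
  "lattice_points S = {x \<in> S. \<forall>i. x i \<in> \<int>}"

text \<open>
  The numbers \<open>h\<^sup>*\<^sub>0, \<dots>, h\<^sup>*\<^sub>d\<close> are determined by the lattice point counts because the defining
  linear system is unitriangular for \<open>m = 0, \<dots>, d\<close>. They exist for lattice polytopes by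
  Ehrhart's theorem.
\<close>

definition h_star :: "(nat \<Rightarrow> real) set \<Rightarrow> nat \<Rightarrow> int" where
  "h_star P = (let d = polytope_dim P in
     THE h. (\<forall>j>d. h j = 0) \<and>
       (\<forall>m. int (card (lattice_points ((\<lambda>x. real m *\<^sub>R x) ` P))) =
            (\<Sum>j\<le>d. h j * int ((m + d - j) choose d))))"

text \<open>
  The \<open>\<gamma>\<close>-vector exists precisely when the \<open>h\<^sup>*\<close>-vector is symmetric, as it is for the
  reflexive polytopes considered here; it is then unique.
\<close>

definition gamma_vec :: "(nat \<Rightarrow> real) set \<Rightarrow> nat \<Rightarrow> int" where
  "gamma_vec P = (let d = polytope_dim P in
     THE g. (\<forall>i>d div 2. g i = 0) \<and>
       (\<Sum>i\<le>d div 2. smult (g i) (monom 1 i * [:1, 1:] ^ (d - 2 * i))) =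
       (\<Sum>j\<le>d. monom (h_star P j) j))"

end

theory Submission
  imports Defs
begin

text \<open>
  With probability tending to \<open>1\<close> the random graph is a forest when \<open>n p(n) \<rightarrow> 0\<close>, and the
  symmetric edge polytope of a forest with \<open>d\<close> edges is, up to a unimodular change of coordinates,
  the \<open>d\<close>-dimensional cross-polytope \<open>{c. \<Sum>\<bar>c\<^sub>e\<bar> \<le> 1}\<close>. The latter has \<open>h\<^sup>*\<close>-polynomial
  \<open>(1 + t)\<^sup>d\<close>, which in the \<open>\<gamma>\<close>-basis is the basis element with index \<open>0\<close>.

  Unimodularity comes from peeling leaves. If a linear combination of edge vectors has all its
  coordinates in an additive subgroup \<open>H\<close> of the reals, but some coefficients are not in \<open>H\<close>, then
  the edges with such coefficients form a nonempty subgraph, which has a leaf; the coordinate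
  at that leaf is one bad coefficient, up to sign, plus an element of \<open>H\<close>, which is absurd
  (\<open>coefficients_in_subgroup\<close>). The case \<open>H = {0}\<close> gives the
  linear independence of the edge vectors, hence the dimension \<open>d\<close>; the case \<open>H = \<int>\<close> identifies
  the lattice points of the \<open>m\<close>-th dilate with the integer points of \<open>\<ell>\<^sup>1\<close>-norm at most \<open>m\<close>
  (\<open>card_lattice_points\<close>). These are counted by
  \<open>\<Sum>\<^sub>j (d choose j) ((m + d - j) choose d)\<close>, because both numbers satisfy the Delannoy recursion
  (\<open>cross_count_recursion\<close>, \<open>l1_ball_finite_card\<close>). So \<open>h\<^sup>*\<^sub>j = d choose j\<close>.

  A graph that is not a forest contains, for some \<open>k \<ge> 1\<close>, a set of \<open>k\<close> edges inside a set of \<open>k\<close>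
  vertices. There are at most \<open>(n e\<^sup>2)\<^sup>k\<close> such configurations, each occurs with
  probability \<open>p\<^sup>k\<close>, and the union bound is a geometric series in \<open>n p e\<^sup>2\<close>, which tends to
  \<open>0\<close> (\<open>prob_not_forest_le\<close>).
\<close>

section \<open>Lattice points in cross-polytopes\<close>

text \<open>
  The coordinates outside \<open>A\<close> are pinned to \<open>0\<close> so that a point of \<open>\<int>\<^sup>A\<close> is represented by exactly
  one function and cardinalities are meaningful.
\<close>

definition l1_ball :: "'a set \<Rightarrow> nat \<Rightarrow> ('a \<Rightarrow> int) set" where
  "l1_ball A m = {c. (\<forall>x. x \<notin> A \<longrightarrow> c x = 0) \<and> (\<Sum>x\<in>A. \<bar>c x\<bar>) \<le> int m}"

text \<open>
  The value at \<open>m\<close> of the Ehrhart polynomial with \<open>h\<^sup>*\<close>-vector \<open>(d choose 0, \<dots>, d choose d)\<close>; these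
  are the Delannoy numbers.
\<close>

definition cross_count :: "nat \<Rightarrow> nat \<Rightarrow> nat" where
  "cross_count d m = (\<Sum>j\<le>d. (d choose j) * ((m + d - j) choose d))"

lemma cross_count_zero_dim [simp]: "cross_count 0 m = 1"
  by (simp add: cross_count_def)

lemma cross_count_zero_radius [simp]: "cross_count d 0 = 1"
proof -
  have "cross_count d 0 = (\<Sum>j\<le>d. if j = 0 then 1 else 0)"
    unfolding cross_count_def by (intro sum.cong) auto
  then show ?thesis by simp
qed

text \<open>
  Pascal's rule on the second binomial coefficient splits off \<open>cross_count (Suc d) m\<close>; Pascal's rule
  on the first one then splits the remaining sum into the two terms for \<open>d\<close>.
\<close>

lemma cross_count_recursion:
  "cross_count (Suc d) (Suc m) = cross_count (Suc d) m + cross_count d (Suc m) + cross_count d m"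
proof -
  \<comment> \<open>The increment of the second binomial coefficient between the radii \<open>m\<close> and \<open>m + 1\<close>.\<close>
  define g where "g j = (m + d + 1 - j) choose d" for j
  have "cross_count (Suc d) (Suc m) =
      (\<Sum>j\<le>Suc d. (Suc d choose j) * ((m + Suc d - j) choose Suc d)) +
      (\<Sum>j\<le>Suc d. (Suc d choose j) * g j)"
    unfolding cross_count_def sum.distrib[symmetric]
  proof (intro sum.cong refl)
    fix j assume "j \<in> {..Suc d}"
    then have "Suc m + Suc d - j = Suc (m + d + 1 - j)" by auto
    then show "(Suc d choose j) * ((Suc m + Suc d - j) choose Suc d) =
        (Suc d choose j) * ((m + Suc d - j) choose Suc d) + (Suc d choose j) * g j"
      by (simp add: g_def algebra_simps)
  qed
  also have "(\<Sum>j\<le>Suc d. (Suc d choose j) * g j) =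
      g 0 + (\<Sum>j\<le>d. (Suc d choose Suc j) * g (Suc j))"
    by (simp add: sum.atMost_Suc_shift del: sum.atMost_Suc binomial_Suc_Suc)
  also have "\<dots> = (g 0 + (\<Sum>j\<le>d. (d choose Suc j) * g (Suc j))) + (\<Sum>j\<le>d. (d choose j) * g (Suc j))"
    by (simp add: sum.distrib algebra_simps)
  also have "g 0 + (\<Sum>j\<le>d. (d choose Suc j) * g (Suc j)) = (\<Sum>j\<le>Suc d. (d choose j) * g j)"
    by (simp add: sum.atMost_Suc_shift del: sum.atMost_Suc)
  also have "\<dots> = cross_count d (Suc m)"
    by (simp add: cross_count_def g_def)
  also have "(\<Sum>j\<le>d. (d choose j) * g (Suc j)) = cross_count d m"
    by (simp add: cross_count_def g_def)
  finally show ?thesis by (simp add: cross_count_def)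
qed

lemma l1_ball_zero_radius: "finite A \<Longrightarrow> l1_ball A 0 = {\<lambda>_. 0}"
proof -
  assume "finite A"
  then have "(\<Sum>x\<in>A. \<bar>c x\<bar>) \<le> 0 \<longleftrightarrow> (\<forall>x\<in>A. c x = 0)" for c :: "'a \<Rightarrow> int"
    by (metis (no_types, lifting) abs_eq_0 abs_ge_zero order_antisym order_refl sum_nonneg sum_nonneg_eq_0_iff)
  then show ?thesis
    unfolding l1_ball_def by (auto simp: fun_eq_iff)
qed

lemma l1_ball_insert_iff:
  assumes "finite A" "a \<notin> A"
  shows "c \<in> l1_ball (insert a A) m \<longleftrightarrow>
    (\<forall>x. x \<notin> insert a A \<longrightarrow> c x = 0) \<and> \<bar>c a\<bar> + (\<Sum>x\<in>A. \<bar>c x\<bar>) \<le> int m"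
  using assms by (simp add: l1_ball_def)

text \<open>
  Moving the coordinate \<open>a\<close> one step towards \<open>0\<close> decreases the norm by one. This matches the points
  of the larger ball on one side (chosen by the sign \<open>s\<close>) of the hyperplane \<open>c a = 0\<close> with
  the closed half of the smaller ball.
\<close>

lemma shift_coordinate_ball:
  fixes s :: int and A :: "'a set"
  assumes "finite A" "a \<notin> A" and s: "\<bar>s\<bar> = 1"
  shows "{c \<in> l1_ball (insert a A) (Suc m). s * c a > 0} =
    (\<lambda>c. c(a := c a + s)) ` {c \<in> l1_ball (insert a A) m. s * c a \<ge> 0}" (is "?L = ?R")
proof
  have s': "s = 1 \<or> s = -1" using s by auto
  have A: "(\<Sum>x\<in>A. \<bar>(c(a := t)) x\<bar>) = (\<Sum>x\<in>A. \<bar>c x\<bar>)" for c :: "'a \<Rightarrow> int" and t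
    using assms(2) by (intro sum.cong) auto
  show "?L \<subseteq> ?R"
  proof
    fix c assume c: "c \<in> ?L"
    have "c = (c(a := c a - s))(a := (c(a := c a - s)) a + s)" by auto
    moreover have "c(a := c a - s) \<in> {c \<in> l1_ball (insert a A) m. s * c a \<ge> 0}"
      using c s' by (auto simp: l1_ball_insert_iff[OF assms(1,2)] A simp del: fun_upd_apply)
        (auto simp: A)
    ultimately show "c \<in> ?R" by (rule image_eqI)
  qed
  show "?R \<subseteq> ?L"
    using s' by (auto simp: l1_ball_insert_iff[OF assms(1,2)] A simp del: fun_upd_apply)
      (auto simp: A)
qed

text \<open>
  In the induction step the ball of radius \<open>m + 1\<close> splits by the sign of the new coordinate. The slice
  at \<open>0\<close> is a ball of one dimension less, and the two open halves are copies of the two closed halves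
  of the ball of radius \<open>m\<close>. The closed halves cover that ball and overlap in its slice at \<open>0\<close>, so the
  sizes satisfy the recursion for \<open>cross_count\<close>.
\<close>

lemma l1_ball_finite_card:
  assumes "finite A"
  shows "finite (l1_ball A m) \<and> card (l1_ball A m) = cross_count (card A) m"
  using assms
proof (induction A arbitrary: m rule: finite_induct)
  case empty
  have "l1_ball {} m = {\<lambda>_ :: 'a. 0 :: int}" by (auto simp: l1_ball_def fun_eq_iff)
  then show ?case by simp
next
  case (insert a A)
  let ?B = "l1_ball (insert a A)"
  show ?case
  proof (induction m)
    case 0
    show ?case using insert(1) by (simp add: l1_ball_zero_radius del: insert_iff)
  next
    case (Suc m)
    define Z where "Z k = {c \<in> ?B k. c a = 0}" for k
    \<comment> \<open>The factors \<open>1\<close> and \<open>-1\<close> are the sign \<open>s\<close> of \<open>shift_coordinate_ball\<close>.\<close>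
    define up where "up = {c \<in> ?B m. 1 * c a \<ge> 0}"
    define down where "down = {c \<in> ?B m. -1 * c a \<ge> 0}"
    have Z: "Z k = l1_ball A k" for k
      unfolding Z_def using insert(1,2)
      by (auto simp: l1_ball_insert_iff) (auto simp: l1_ball_def)
    have fin: "finite up" "finite down" using Suc by (auto simp: up_def down_def)
    have split: "?B (Suc m) = Z (Suc m) \<union> ({c \<in> ?B (Suc m). 1 * c a > 0} \<union> {c \<in> ?B (Suc m). -1 * c a > 0})"
      by (auto simp: Z_def)
    have inj: "inj_on (\<lambda>c :: 'a \<Rightarrow> int. c(a := c a + s)) X" for s X
      by (rule inj_onI) (auto simp: fun_eq_iff split: if_splits)
    have pos: "{c \<in> ?B (Suc m). 1 * c a > 0} = (\<lambda>c. c(a := c a + 1)) ` up"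
      unfolding up_def by (rule shift_coordinate_ball[OF insert(1,2)]) simp
    have neg: "{c \<in> ?B (Suc m). -1 * c a > 0} = (\<lambda>c. c(a := c a + -1)) ` down"
      unfolding down_def by (rule shift_coordinate_ball[OF insert(1,2)]) simp
    have finpos: "finite {c \<in> ?B (Suc m). 1 * c a > 0}" unfolding pos using fin by simp
    have finneg: "finite {c \<in> ?B (Suc m). -1 * c a > 0}" unfolding neg using fin by simp
    have finZ: "finite (Z (Suc m))" using insert(3) by (simp add: Z)
    have fB: "finite (?B (Suc m))"
      by (subst split) (intro finite_UnI finpos finneg finZ)
    have "card (?B (Suc m)) = card (Z (Suc m)) + (card {c \<in> ?B (Suc m). 1 * c a > 0} + card {c \<in> ?B (Suc m). -1 * c a > 0})"
    proof -
      have disj: "Z (Suc m) \<inter> ({c \<in> ?B (Suc m). 1 * c a > 0} \<union> {c \<in> ?B (Suc m). -1 * c a > 0}) = {}"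
        "{c \<in> ?B (Suc m). 1 * c a > 0} \<inter> {c \<in> ?B (Suc m). -1 * c a > 0} = {}"
        by (auto simp: Z_def)
      show ?thesis
        unfolding card_Un_disjoint[OF finpos finneg disj(2), symmetric]
          card_Un_disjoint[OF finZ finite_UnI[OF finpos finneg] disj(1), symmetric]
        by (rule arg_cong[OF split])
    qed
    also have "\<dots> = card (Z (Suc m)) + (card up + card down)"
      unfolding pos neg by (simp only: card_image[OF inj])
    also have "card up + card down = card (up \<union> down) + card (up \<inter> down)"
      using fin by (rule card_Un_Int)
    also have "up \<union> down = ?B m" by (auto simp: up_def down_def)
    also have "up \<inter> down = Z m" by (auto simp: up_def down_def Z_def)
    finally have "card (?B (Suc m)) = cross_count (Suc (card A)) (Suc m)"
      using Suc insert(3) by (simp add: Z cross_count_recursion insert(1,2))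
    then show ?case using fB insert(1,2) by simp
  qed
qed

section \<open>The \<open>h\<^sup>*\<close>- and \<open>\<gamma>\<close>-vector of a cross-polytope\<close>

text \<open>
  The linear system is unitriangular: at \<open>m\<close>, the summands with \<open>j > m\<close> vanish and the one with
  \<open>j = m\<close> has coefficient \<open>1\<close>.
\<close>

lemma h_star_unique:
  fixes h h' :: "nat \<Rightarrow> int"
  assumes "\<forall>j>d. h j = 0" "\<forall>j>d. h' j = 0"
    and eq: "\<And>m. (\<Sum>j\<le>d. h j * int ((m + d - j) choose d)) = (\<Sum>j\<le>d. h' j * int ((m + d - j) choose d))"
  shows "h = h'"
proof
  fix m show "h m = h' m"
  proof (induction m rule: less_induct)
    case (less m)
    show ?case
    proof (cases "m \<le> d")
      case True
      have "0 = (\<Sum>j\<le>d. (h j - h' j) * int ((m + d - j) choose d))"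
        using eq[of m] by (simp add: left_diff_distrib sum_subtractf)
      also have "\<dots> = (\<Sum>j\<le>d. if j = m then h m - h' m else 0)"
        using less by (intro sum.cong refl) (auto simp: binomial_eq_0 not_less_iff_gr_or_eq)
      finally show ?thesis using True by simp
    qed (use assms in auto)
  qed
qed

text \<open>
  Comparing coefficients of \<open>t\<^sup>m\<close> is again a unitriangular system, since \<open>t\<^sup>i (1 + t)\<^sup>k\<close> starts with
  \<open>t\<^sup>i\<close>.
\<close>

lemma gamma_unique:
  fixes g g' :: "nat \<Rightarrow> int"
  assumes "\<forall>i>n. g i = 0" "\<forall>i>n. g' i = 0"
    and eq: "(\<Sum>i\<le>n. smult (g i) (monom 1 i * [:1, 1:] ^ (d - 2 * i))) =
             (\<Sum>i\<le>n. smult (g' i) (monom 1 i * [:1, 1:] ^ (d - 2 * i)))"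
  shows "g = g'"
proof
  have one: "coeff ([:1, 1:] ^ k) 0 = (1 :: int)" for k
    by (simp add: coeff_0_power)
  fix m show "g m = g' m"
  proof (induction m rule: less_induct)
    case (less m)
    show ?case
    proof (cases "m \<le> n")
      case True
      have "0 = coeff ((\<Sum>i\<le>n. smult (g i - g' i) (monom 1 i * [:1, 1:] ^ (d - 2 * i)))) m"
        using eq by (simp add: smult_diff_left sum_subtractf)
      also have "\<dots> = (\<Sum>i\<le>n. if i = m then g m - g' m else 0)"
        unfolding coeff_sum
        using less by (intro sum.cong refl) (auto simp: coeff_monom_mult one not_less_iff_gr_or_eq)
      finally show ?thesis using True by simp
    qed (use assms in auto)
  qed
qed

lemma h_star_cross:
  assumes "\<And>m. card (lattice_points ((\<lambda>x. real m *\<^sub>R x) ` P)) = cross_count (polytope_dim P) m"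
  shows "h_star P j = int (polytope_dim P choose j)"
proof -
  have "h_star P = (\<lambda>j. int (polytope_dim P choose j))"
    unfolding h_star_def Let_def
  proof (rule the_equality, goal_cases)
    case 1
    then show ?case by (auto simp: assms cross_count_def)
  next
    case (2 h)
    then show ?case
      by (intro h_star_unique[of "polytope_dim P"]) (auto simp: assms cross_count_def)
  qed
  then show ?thesis by simp
qed

text \<open>
  The \<open>h\<^sup>*\<close>-polynomial is \<open>(1 + t)\<^sup>d\<close> by the binomial theorem, and this is the \<open>\<gamma>\<close>-basis element
  with index \<open>0\<close>.
\<close>

lemma gamma_vec_cross:
  assumes "\<And>j. h_star P j = int (polytope_dim P choose j)"
  shows "gamma_vec P = (\<lambda>i. if i = 0 then 1 else 0)"
proof -
  let ?d = "polytope_dim P"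
  have "(\<Sum>i\<le>?d div 2. smult (if i = 0 then 1 else 0) (monom 1 i * [:1, 1:] ^ (?d - 2 * i)))
      = (\<Sum>i\<le>?d div 2. if i = 0 then [:1, 1 :: int:] ^ ?d else 0)"
    by (intro sum.cong) (auto simp: monom_0)
  also have "\<dots> = [:1, 1:] ^ ?d" by simp
  also have "\<dots> = (monom 1 1 + 1) ^ ?d" by (simp add: monom_altdef one_pCons)
  also have "\<dots> = (\<Sum>j\<le>?d. monom (h_star P j) j)"
    unfolding binomial_ring assms
    by (intro sum.cong refl) (simp add: monom_power of_nat_monom mult_monom)
  finally have *: "(\<Sum>i\<le>?d div 2. smult (if i = 0 then 1 else 0) (monom 1 i * [:1, 1:] ^ (?d - 2 * i)))
      = (\<Sum>j\<le>?d. monom (h_star P j) j)" .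
  show ?thesis
    unfolding gamma_vec_def Let_def
  proof (rule the_equality, goal_cases)
    case 1
    show ?case using * by auto
  next
    case (2 g)
    then show ?case
      using * by (intro gamma_unique[of "?d div 2" _ _ ?d]) auto
  qed
qed

section \<open>Symmetric edge polytopes of forests\<close>

text \<open>
  Acyclicity is expressed by counting: a cycle has as many edges as vertices, whereas a nonempty set
  of edges of a forest always meets more vertices than it has edges. In this form the failure of the
  condition is directly an event for the union bound over small dense subgraphs.
\<close>

locale forest =
  fixes E :: "nat set set"
  assumes finite_edges: "finite E"
    and card_edge: "e \<in> E \<Longrightarrow> card e = 2"
    and sparse: "F \<subseteq> E \<Longrightarrow> F \<noteq> {} \<Longrightarrow> card F < card (\<Union>F)"
begin

text \<open>
  Handshaking: if every vertex of \<open>F\<close> had degree at least \<open>2\<close>, then \<open>2 |V(F)| \<le> 2 |F|\<close>, against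
  sparsity.
\<close>

lemma leaf_exists:
  assumes F: "F \<subseteq> E" "F \<noteq> {}"
  obtains v e where "e \<in> F" "{e' \<in> F. v \<in> e'} = {e}"
proof -
  have finF: "finite F" using F finite_edges by (auto intro: finite_subset)
  have "finite e" if "e \<in> F" for e
    using card_edge[of e] that F(1) by (intro card_ge_0_finite) auto
  then have fin: "finite (\<Union>F)" using finF by blast
  have "\<exists>v\<in>\<Union>F. card {e \<in> F. v \<in> e} < 2"
  proof (rule ccontr)
    assume "\<not> ?thesis"
    then have "2 * card (\<Union>F) \<le> (\<Sum>v\<in>\<Union>F. card {e \<in> F. v \<in> e})"
      using sum_bounded_below[of "\<Union>F" 2 "\<lambda>v. card {e \<in> F. v \<in> e}"] by (auto simp: not_less mult.commute)
    also have "\<dots> = (\<Sum>e\<in>F. 2)"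
    proof (rule sum_multicount_gen[OF fin finF], rule ballI)
      fix e assume e: "e \<in> F"
      then have "{v \<in> \<Union>F. v \<in> e} = e" by auto
      then show "card {v \<in> \<Union>F. v \<in> e} = 2" using e F card_edge by auto
    qed
    finally show False using sparse[OF F] by simp
  qed
  then obtain v e where v: "card {e \<in> F. v \<in> e} < 2" "e \<in> F" "v \<in> e" by auto
  have "card {e \<in> F. v \<in> e} \<noteq> 0" using v finF by auto
  then have "card {e \<in> F. v \<in> e} = 1" using v by auto
  then obtain e' where "{e \<in> F. v \<in> e} = {e'}" by (auto simp: card_1_singleton_iff)
  with v show ?thesis by (intro that[of e v]) auto
qed

text \<open>
  An arbitrary choice of one of the two vertices \<open>\<plusminus>(e\<^sub>i - e\<^sub>j)\<close> that belong to an edge.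
\<close>

definition edge_vec :: "nat set \<Rightarrow> nat \<Rightarrow> real" where
  "edge_vec e = unit_vec (Min e) - unit_vec (Max e)"

definition edge_comb :: "(nat set \<Rightarrow> real) \<Rightarrow> nat \<Rightarrow> real" where
  "edge_comb c = (\<Sum>e\<in>E. c e *\<^sub>R edge_vec e)"

lemma edge_comb_apply: "edge_comb c v = (\<Sum>e\<in>E. c e * edge_vec e v)"
proof -
  have "finite F \<Longrightarrow> (\<Sum>e\<in>F. c e *\<^sub>R edge_vec e) v = (\<Sum>e\<in>F. c e * edge_vec e v)" for F
    by (induction F rule: finite_induct) (auto simp: scaleR_fun_def plus_fun_def zero_fun_def)
  then show ?thesis using finite_edges by (simp add: edge_comb_def)
qed

lemma edge_comb_cong: "(\<And>e. e \<in> E \<Longrightarrow> c e = c' e) \<Longrightarrow> edge_comb c = edge_comb c'"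
  unfolding edge_comb_def by (intro sum.cong) auto

lemma edge_comb_diff: "edge_comb c - edge_comb c' = edge_comb (\<lambda>e. c e - c' e)"
  by (simp add: edge_comb_def scaleR_left_diff_distrib sum_subtractf)

lemma edge_comb_scaleR: "r *\<^sub>R edge_comb c = edge_comb (\<lambda>e. r * c e)"
  by (simp add: edge_comb_def scaleR_sum_right)

lemma edge_comb_add: "edge_comb c + edge_comb c' = edge_comb (\<lambda>e. c e + c' e)"
  by (simp add: edge_comb_def scaleR_left_distrib sum.distrib)

lemma edge_cases:
  assumes "e \<in> E"
  obtains i j where "e = {i, j}" "i < j" "edge_vec e = unit_vec i - unit_vec j"
proof -
  obtain i j where "e = {i, j}" "i \<noteq> j"
    using card_edge[OF assms] by (auto simp: card_2_iff)
  then show ?thesis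
    using that[of i j] that[of j i]
    by (cases "i < j") (auto simp: edge_vec_def min_def max_def insert_commute)
qed

lemma edge_vec_entry:
  assumes "e \<in> E"
  shows "v \<in> e \<Longrightarrow> edge_vec e v = 1 \<or> edge_vec e v = -1"
    and "v \<notin> e \<Longrightarrow> edge_vec e v = 0"
    and "edge_vec e v \<in> \<int>"
  using assms by (auto elim!: edge_cases simp: unit_vec_def)

text \<open>
  The leaf argument. Among the edges whose coefficient is not in \<open>H\<close> choose one with a leaf \<open>v\<close>. Every
  other edge at \<open>v\<close> has its coefficient in \<open>H\<close>, so the \<open>v\<close>-th coordinate of the combination forces
  the remaining coefficient into \<open>H\<close> as well.
\<close>

lemma coefficients_in_subgroup:
  fixes H :: "real set"
  assumes zero: "0 \<in> H" and diff: "\<And>x y. x \<in> H \<Longrightarrow> y \<in> H \<Longrightarrow> x - y \<in> H"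
    and edge_comb: "\<And>v. edge_comb c v \<in> H" and e: "e \<in> E"
  shows "c e \<in> H"
proof (rule ccontr)
  have minus: "- x \<in> H" if "x \<in> H" for x using diff[OF zero that] by simp
  have add: "x + y \<in> H" if "x \<in> H" "y \<in> H" for x y using diff[OF that(1) minus[OF that(2)]] by simp
  define F where "F = {e \<in> E. c e \<notin> H}"
  assume "c e \<notin> H"
  then have "F \<subseteq> E" "F \<noteq> {}" using e by (auto simp: F_def)
  then obtain v f where f: "f \<in> F" "{e' \<in> F. v \<in> e'} = {f}" by (rule leaf_exists)
  have fE: "f \<in> E" "c f \<notin> H" "v \<in> f" using f by (auto simp: F_def)
  have "(\<Sum>e\<in>X. c e * edge_vec e v) \<in> H" if "finite X" "X \<subseteq> E - {f}" for X
    using that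
  proof (induction X rule: finite_induct)
    case (insert x X)
    then have x: "x \<in> E" "x \<noteq> f" by auto
    have "c x * edge_vec x v \<in> H"
    proof (cases "v \<in> x")
      case True
      then have "c x \<in> H" using f x by (auto simp: F_def)
      then show ?thesis using edge_vec_entry(1)[OF x(1) True] minus by auto
    qed (use edge_vec_entry(2) x zero in auto)
    with insert show ?case by (auto intro: add)
  qed (use zero in auto)
  then have "edge_comb c v - (\<Sum>e\<in>E - {f}. c e * edge_vec e v) \<in> H"
    using finite_edges by (intro diff edge_comb) auto
  also have "edge_comb c v - (\<Sum>e\<in>E - {f}. c e * edge_vec e v) = c f * edge_vec f v"
    unfolding edge_comb_apply using finite_edges fE(1) by (simp add: sum.remove)
  finally show False
    using edge_vec_entry(1)[OF fE(1,3)] fE(2) minus by fastforce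
qed

lemma edge_comb_eq_imp:
  assumes "edge_comb c = edge_comb c'" "e \<in> E"
  shows "c e = c' e"
proof -
  have "c e - c' e \<in> {0}"
    by (rule coefficients_in_subgroup) (use assms in \<open>auto simp flip: edge_comb_diff\<close>)
  then show ?thesis by simp
qed

text \<open>
  Unimodularity: the edge vectors are a basis of the lattice of integer points in their span.
\<close>

lemma edge_comb_lattice_iff: "(\<forall>v. edge_comb c v \<in> \<int>) \<longleftrightarrow> (\<forall>e\<in>E. c e \<in> \<int>)"
  using coefficients_in_subgroup[of \<int> c] edge_vec_entry(3)
  by (auto simp: edge_comb_apply intro!: Ints_sum Ints_mult)

lemma edge_vec_eq_comb:
  assumes "e \<in> E" shows "edge_vec e = edge_comb (\<lambda>x. if x = e then 1 else 0)"
  using assms finite_edges by (auto simp: edge_comb_def if_distrib[of "\<lambda>r. r *\<^sub>R _"] cong: if_cong)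

lemma inj_on_edge_vec: "inj_on edge_vec E"
proof (rule inj_onI)
  fix x y assume xy: "x \<in> E" "y \<in> E" "edge_vec x = edge_vec y"
  then show "x = y"
    using edge_comb_eq_imp[of "\<lambda>z. if z = x then 1 else 0" "\<lambda>z. if z = y then 1 else 0" x]
    by (auto simp: edge_vec_eq_comb split: if_splits)
qed

lemma independent_edge_vec: "independent (edge_vec ` E)"
proof (rule independent_if_scalars_zero)
  show "finite (edge_vec ` E)" using finite_edges by simp
  fix f x assume f: "(\<Sum>x\<in>edge_vec ` E. f x *\<^sub>R x) = 0" and x: "x \<in> edge_vec ` E"
  then have "edge_comb (\<lambda>e. f (edge_vec e)) = edge_comb (\<lambda>e. 0)"
    by (simp add: edge_comb_def sum.reindex[OF inj_on_edge_vec])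
  then show "f x = 0" using x edge_comb_eq_imp by fastforce
qed

definition cross_polytope :: "real \<Rightarrow> (nat \<Rightarrow> real) set" where
  "cross_polytope r = {edge_comb c | c. (\<Sum>e\<in>E. \<bar>c e\<bar>) \<le> r}"

lemma zero_in_cross: "r \<ge> 0 \<Longrightarrow> 0 \<in> cross_polytope r"
  by (auto simp: cross_polytope_def edge_comb_def intro!: exI[of _ "\<lambda>_. 0"])

lemma edge_vec_in_cross:
  assumes "e \<in> E" shows "edge_vec e \<in> cross_polytope 1" "- edge_vec e \<in> cross_polytope 1"
proof -
  show "edge_vec e \<in> cross_polytope 1"
    unfolding cross_polytope_def using edge_vec_eq_comb[OF assms] finite_edges assms
    by (auto intro!: exI[of _ "\<lambda>x. if x = e then 1 else 0"] simp: if_distrib[of abs] cong: if_cong)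
  have "- edge_vec e = edge_comb (\<lambda>x. if x = e then -1 else 0)"
    using assms finite_edges by (auto simp: edge_comb_def if_distrib[of "\<lambda>r. r *\<^sub>R _"] cong: if_cong)
  then show "- edge_vec e \<in> cross_polytope 1"
    unfolding cross_polytope_def using finite_edges assms
    by (auto intro!: exI[of _ "\<lambda>x. if x = e then -1 else 0"] simp: if_distrib[of abs] cong: if_cong)
qed

lemma convex_cross: "convex (cross_polytope r)"
proof (rule convexI)
  fix x y and u v :: real
  assume "x \<in> cross_polytope r" "y \<in> cross_polytope r" and uv: "0 \<le> u" "0 \<le> v" "u + v = 1"
  then obtain c c' where c: "x = edge_comb c" "(\<Sum>e\<in>E. \<bar>c e\<bar>) \<le> r" "y = edge_comb c'" "(\<Sum>e\<in>E. \<bar>c' e\<bar>) \<le> r"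
    by (auto simp: cross_polytope_def)
  have "(\<Sum>e\<in>E. \<bar>u * c e + v * c' e\<bar>) \<le> (\<Sum>e\<in>E. u * \<bar>c e\<bar> + v * \<bar>c' e\<bar>)"
    using uv by (intro sum_mono) (metis abs_mult abs_of_nonneg abs_triangle_ineq)
  also have "\<dots> = u * (\<Sum>e\<in>E. \<bar>c e\<bar>) + v * (\<Sum>e\<in>E. \<bar>c' e\<bar>)"
    by (simp add: sum.distrib sum_distrib_left)
  also have "\<dots> \<le> r" using c uv by (intro convex_bound_le) auto
  finally show "u *\<^sub>R x + v *\<^sub>R y \<in> cross_polytope r"
    unfolding cross_polytope_def c edge_comb_scaleR edge_comb_add by blast
qed

lemma generators_eq:
  "{unit_vec i - unit_vec j | i j. {i, j} \<in> E} = edge_vec ` E \<union> uminus ` edge_vec ` E" (is "?G = ?R")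
proof
  show "?G \<subseteq> ?R"
  proof
    fix x assume "x \<in> ?G"
    then obtain i j where x: "x = unit_vec i - unit_vec j" "{i, j} \<in> E" by auto
    have "i \<noteq> j" using card_edge[OF x(2)] by auto
    then have "x = edge_vec {i, j} \<or> x = - edge_vec {i, j}"
      by (auto simp: edge_vec_def x min_def max_def)
    then show "x \<in> ?R" using x(2) by auto
  qed
  show "?R \<subseteq> ?G"
  proof -
    have "edge_vec e \<in> ?G \<and> - edge_vec e \<in> ?G" if "e \<in> E" for e
    proof -
      obtain i j where ij: "e = {i, j}" "edge_vec e = unit_vec i - unit_vec j"
        using edge_cases[OF \<open>e \<in> E\<close>] by metis
      then have "- edge_vec e = unit_vec j - unit_vec i" "{j, i} \<in> E"
        using \<open>e \<in> E\<close> by (simp_all add: insert_commute)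
      then show ?thesis using ij \<open>e \<in> E\<close> by blast
    qed
    then show ?thesis by blast
  qed
qed

text \<open>
  For the inclusion of the cross-polytope in the hull, a combination of \<open>\<ell>\<^sup>1\<close>-norm \<open>s \<le> 1\<close> is \<open>s\<close> times
  a convex combination of signed edge vectors, and the missing weight \<open>1 - s\<close> is put on the origin,
  the midpoint of two opposite generators.
\<close>

lemma sym_edge_polytope_eq_cross: "sym_edge_polytope E = cross_polytope 1"
proof (cases "E = {}")
  case True
  have "edge_comb c = 0" "(\<Sum>e\<in>E. \<bar>c e\<bar>) \<le> 1" for c
    unfolding edge_comb_def by (simp_all add: True)
  then have "cross_polytope 1 = {0}" unfolding cross_polytope_def by auto
  then show ?thesis using True unfolding sym_edge_polytope_def by argo
next
  case False
  let ?P = "convex hull (edge_vec ` E \<union> uminus ` edge_vec ` E)"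
  have gen: "edge_vec e \<in> ?P" "- edge_vec e \<in> ?P" if "e \<in> E" for e
    using that by (auto intro!: hull_inc)
  have zero: "0 \<in> ?P"
  proof -
    obtain e where "e \<in> E" using False by auto
    from convexD[OF convex_convex_hull gen[OF this], of "1/2" "1/2"] show ?thesis by simp
  qed
  have "?P = cross_polytope 1"
  proof
    show "?P \<subseteq> cross_polytope 1"
      by (intro hull_minimal convex_cross) (auto intro: edge_vec_in_cross)
    show "cross_polytope 1 \<subseteq> ?P"
    proof
      fix x assume "x \<in> cross_polytope 1"
      then obtain c where c: "x = edge_comb c" "(\<Sum>e\<in>E. \<bar>c e\<bar>) \<le> 1" by (auto simp: cross_polytope_def)
      define s where "s = (\<Sum>e\<in>E. \<bar>c e\<bar>)"
      have s: "0 \<le> s" "s \<le> 1" using c by (auto simp: s_def sum_nonneg)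
      show "x \<in> ?P"
      proof (cases "s = 0")
        case True
        then have "\<forall>e\<in>E. c e = 0"
          using finite_edges by (auto simp: s_def sum_nonneg_eq_0_iff)
        then show ?thesis using zero by (simp add: c edge_comb_def)
      next
        case False
        have "(\<Sum>e\<in>E. (\<bar>c e\<bar> / s) *\<^sub>R (if c e \<ge> 0 then edge_vec e else - edge_vec e)) \<in> ?P"
          by (rule convex_sum)
            (use False s finite_edges gen in \<open>auto simp: convex_convex_hull s_def sum_divide_distrib[symmetric]\<close>)
        also have "(\<Sum>e\<in>E. (\<bar>c e\<bar> / s) *\<^sub>R (if c e \<ge> 0 then edge_vec e else - edge_vec e)) = edge_comb (\<lambda>e. c e / s)"
          unfolding edge_comb_def by (intro sum.cong) auto
        finally have y: "edge_comb (\<lambda>e. c e / s) \<in> ?P" .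
        have "s *\<^sub>R edge_comb (\<lambda>e. c e / s) + (1 - s) *\<^sub>R 0 \<in> ?P"
          by (rule convexD[OF convex_convex_hull y zero]) (use s in auto)
        then show ?thesis using False by (simp add: edge_comb_scaleR c)
      qed
    qed
  qed
  with False show ?thesis by (simp add: sym_edge_polytope_def generators_eq)
qed

lemma dilate_cross:
  assumes "r \<ge> 0" shows "(\<lambda>x. r *\<^sub>R x) ` cross_polytope 1 = cross_polytope r"
proof (cases "r = 0")
  case True
  have "edge_comb c = 0" if "(\<Sum>e\<in>E. \<bar>c e\<bar>) \<le> 0" for c
  proof -
    have "(\<Sum>e\<in>E. \<bar>c e\<bar>) = 0" using that by (intro antisym sum_nonneg) auto
    then show ?thesis using finite_edges by (simp add: sum_nonneg_eq_0_iff edge_comb_def)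
  qed
  then have "cross_polytope 0 \<subseteq> {0}" by (auto simp: cross_polytope_def)
  then have "cross_polytope 0 = {0}" using zero_in_cross[of 0] by auto
  then show ?thesis using True zero_in_cross[of 1] by (auto simp: image_def)
next
  case False
  show ?thesis
  proof
    show "(\<lambda>x. r *\<^sub>R x) ` cross_polytope 1 \<subseteq> cross_polytope r"
    proof
      fix x assume "x \<in> (\<lambda>x. r *\<^sub>R x) ` cross_polytope 1"
      then obtain c where c: "x = r *\<^sub>R edge_comb c" "(\<Sum>e\<in>E. \<bar>c e\<bar>) \<le> 1" by (auto simp: cross_polytope_def)
      have "(\<Sum>e\<in>E. \<bar>r * c e\<bar>) = r * (\<Sum>e\<in>E. \<bar>c e\<bar>)"
        using assms by (simp add: sum_distrib_left abs_mult)
      also have "\<dots> \<le> r" using c assms by (simp add: mult_left_le)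
      finally show "x \<in> cross_polytope r" unfolding cross_polytope_def c edge_comb_scaleR by blast
    qed
    show "cross_polytope r \<subseteq> (\<lambda>x. r *\<^sub>R x) ` cross_polytope 1"
    proof
      fix x assume "x \<in> cross_polytope r"
      then obtain c where c: "x = edge_comb c" "(\<Sum>e\<in>E. \<bar>c e\<bar>) \<le> r" by (auto simp: cross_polytope_def)
      have "(\<Sum>e\<in>E. \<bar>c e / r\<bar>) = (\<Sum>e\<in>E. \<bar>c e\<bar>) / r"
        using assms by (simp add: sum_divide_distrib)
      also have "\<dots> \<le> 1" using c False assms by (simp add: divide_le_eq)
      finally have "edge_comb (\<lambda>e. c e / r) \<in> cross_polytope 1" unfolding cross_polytope_def by blast
      moreover have "x = r *\<^sub>R edge_comb (\<lambda>e. c e / r)" using False by (simp add: c edge_comb_scaleR)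
      ultimately show "x \<in> (\<lambda>x. r *\<^sub>R x) ` cross_polytope 1" by blast
    qed
  qed
qed

lemma polytope_dim_eq: "polytope_dim (sym_edge_polytope E) = card E"
proof -
  have "affine hull (cross_polytope 1) = span (cross_polytope 1)"
    by (intro affine_hull_span_0 hull_inc zero_in_cross) simp
  also have "\<dots> = span (edge_vec ` E)"
  proof (rule span_eq[THEN iffD2], intro conjI)
    have "edge_comb c \<in> span (edge_vec ` E)" for c
      unfolding edge_comb_def by (intro span_sum span_scale span_base imageI)
    then show "cross_polytope 1 \<subseteq> span (edge_vec ` E)" by (auto simp: cross_polytope_def)
    show "edge_vec ` E \<subseteq> span (cross_polytope 1)"
      by (auto intro!: span_base edge_vec_in_cross)
  qed
  finally have hull: "affine hull (cross_polytope 1) = span (edge_vec ` E)" .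
  have "{x - y | x y. x \<in> span S \<and> y \<in> span S} = span S" for S :: "(nat \<Rightarrow> real) set"
  proof
    show "span S \<subseteq> {x - y | x y. x \<in> span S \<and> y \<in> span S}"
    proof
      fix x assume "x \<in> span S"
      moreover have "x = x - 0" by simp
      ultimately show "x \<in> {x - y | x y. x \<in> span S \<and> y \<in> span S}"
        using span_zero by blast
    qed
  qed (auto intro: span_diff)
  then show ?thesis
    unfolding polytope_dim_def sym_edge_polytope_eq_cross hull
    by (simp add: dim_eq_card_independent[OF independent_edge_vec] card_image inj_on_edge_vec)
qed

text \<open>
  By unimodularity, taking coefficients is a bijection from the lattice points of the dilate onto the
  integer points of an \<open>\<ell>\<^sup>1\<close>-ball.
\<close>

lemma card_lattice_points:
  "card (lattice_points ((\<lambda>x. real m *\<^sub>R x) ` sym_edge_polytope E)) = cross_count (card E) m"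
proof -
  let ?\<phi> = "\<lambda>b :: nat set \<Rightarrow> int. edge_comb (\<lambda>e. real_of_int (b e))"
  have "lattice_points (cross_polytope (real m)) = ?\<phi> ` l1_ball E m"
  proof
    show "lattice_points (cross_polytope (real m)) \<subseteq> ?\<phi> ` l1_ball E m"
    proof
      fix x assume x: "x \<in> lattice_points (cross_polytope (real m))"
      then obtain c where c: "x = edge_comb c" "(\<Sum>e\<in>E. \<bar>c e\<bar>) \<le> real m"
        by (auto simp: lattice_points_def cross_polytope_def)
      have int: "\<forall>e\<in>E. c e \<in> \<int>"
        using x by (auto simp: lattice_points_def c simp flip: edge_comb_lattice_iff)
      define b where "b e = (if e \<in> E then \<lfloor>c e\<rfloor> else 0)" for e
      have b: "real_of_int (b e) = c e" if "e \<in> E" for e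
        using int that by (auto simp: b_def elim!: Ints_cases)
      have "real_of_int (\<Sum>e\<in>E. \<bar>b e\<bar>) \<le> real_of_int (int m)"
        using c(2) by (simp add: b)
      then have "b \<in> l1_ball E m"
        unfolding of_int_le_iff by (simp add: l1_ball_def b_def)
      moreover have "x = ?\<phi> b" unfolding c by (rule edge_comb_cong) (simp add: b)
      ultimately show "x \<in> ?\<phi> ` l1_ball E m" by blast
    qed
    show "?\<phi> ` l1_ball E m \<subseteq> lattice_points (cross_polytope (real m))"
    proof
      fix x assume "x \<in> ?\<phi> ` l1_ball E m"
      then obtain b where b: "x = ?\<phi> b" "(\<Sum>e\<in>E. \<bar>b e\<bar>) \<le> int m" by (auto simp: l1_ball_def)
      have "real_of_int (\<Sum>e\<in>E. \<bar>b e\<bar>) \<le> real_of_int (int m)"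
        using b(2) by (simp only: of_int_le_iff)
      then have "x \<in> cross_polytope (real m)" unfolding cross_polytope_def b(1) by auto
      moreover have "\<forall>v. x v \<in> \<int>" unfolding b(1) edge_comb_lattice_iff by simp
      ultimately show "x \<in> lattice_points (cross_polytope (real m))" by (simp add: lattice_points_def)
    qed
  qed
  moreover have "inj_on ?\<phi> (l1_ball E m)"
  proof (rule inj_onI, rule ext)
    fix b b' e assume *: "b \<in> l1_ball E m" "b' \<in> l1_ball E m" "?\<phi> b = ?\<phi> b'"
    show "b e = b' e"
    proof (cases "e \<in> E")
      case True
      then show ?thesis using edge_comb_eq_imp[OF *(3)] by simp
    qed (use * in \<open>simp add: l1_ball_def\<close>)
  qed
  ultimately have "card (lattice_points (cross_polytope (real m))) = card (l1_ball E m)"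
    by (simp only: card_image)
  then show ?thesis
    using l1_ball_finite_card[OF finite_edges, of m]
    unfolding sym_edge_polytope_eq_cross dilate_cross[OF of_nat_0_le_iff] by argo
qed

lemma gamma_vec_forest: "gamma_vec (sym_edge_polytope E) = (\<lambda>k. if k = 0 then 1 else 0)"
proof (rule gamma_vec_cross, rule h_star_cross)
  show "card (lattice_points ((\<lambda>x. real m *\<^sub>R x) ` sym_edge_polytope E)) =
      cross_count (polytope_dim (sym_edge_polytope E)) m" for m
    unfolding polytope_dim_eq by (rule card_lattice_points)
qed

end

section \<open>Sparse random graphs are forests\<close>

lemma finite_all_edges: "finite (all_edges n)"
  unfolding all_edges_def by (rule finite_subset[of _ "Pow {1..n}"]) auto

lemma prob_contains_edges:
  assumes F: "F \<subseteq> all_edges n" and q: "0 \<le> q" "q \<le> 1"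
  shows "measure_pmf.prob (erdos_renyi n q) {E. F \<subseteq> E} = q ^ card F"
proof -
  let ?A = "all_edges n"
  let ?B = "\<lambda>e. if e \<in> F then {True} else UNIV"
  have "(\<lambda>f. {e \<in> ?A. f e}) -` {E. F \<subseteq> E} = Pi ?A ?B"
    using F by (auto simp: Pi_def split: if_splits)
  then have "measure_pmf.prob (erdos_renyi n q) {E. F \<subseteq> E} =
      (\<Prod>e\<in>?A. measure_pmf.prob (bernoulli_pmf q) (?B e))"
    unfolding erdos_renyi_def by (simp add: measure_Pi_pmf_Pi finite_all_edges)
  also have "\<dots> = (\<Prod>e\<in>?A. if e \<in> F then q else 1)"
    using q by (intro prod.cong refl) (auto simp: measure_pmf_single)
  also have "\<dots> = q ^ card F"
    using F by (simp add: prod.If_cases finite_all_edges Int_absorb1)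
  finally show ?thesis .
qed

text \<open>
  The obstructions to being a forest, with as many edges as vertices. The vertex set is recorded
  separately, although \<open>F\<close> need not meet all of it, because this makes the pairs easy to count.
\<close>

definition dense_pairs :: "nat \<Rightarrow> nat \<Rightarrow> (nat set \<times> nat set set) set" where
  "dense_pairs n k = (SIGMA S : {S. S \<subseteq> {1..n} \<and> card S = k}.
     {F. F \<subseteq> {e. e \<subseteq> S \<and> card e = 2} \<and> card F = k})"

text \<open>
  The left-hand side divided by \<open>k!\<close> is a single term of the exponential series at \<open>k\<close>.
\<close>

lemma power_le_fact_exp: "real k ^ k \<le> fact k * exp (real k)"
proof -
  have "real k ^ k / fact k \<le> exp (real k)"
    using sum_le_suminf[OF summable_exp_generic[of "real k"], of "{k}"]
    by (simp add: exp_def field_simps)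
  then show ?thesis by (simp add: field_simps)
qed

lemma binomial_le_power_fact: "real (n choose k) \<le> real n ^ k / fact k"
proof -
  have "real ((n choose k) * fact k) \<le> real (n ^ k)"
    using binomial_fact_pow of_nat_le_iff by blast
  then show ?thesis by (simp add: field_simps)
qed

text \<open>
  There are \<open>(n choose k) ((k choose 2) choose k) \<le> (n\<^sup>k / k!) ((k\<^sup>2)\<^sup>k / k!)\<close> pairs, and \<open>k\<^sup>k / k! \<le> e\<^sup>k\<close>
  is used twice. It is essential that the bound is only exponential in \<open>k\<close>.
\<close>

lemma dense_pairs_finite_card:
  "finite (dense_pairs n k)" "real (card (dense_pairs n k)) \<le> (real n * exp 2) ^ k"
proof -
  let ?T = "{S. S \<subseteq> {1..n} \<and> card S = k}"
  let ?U = "\<lambda>S. {F. F \<subseteq> {e. e \<subseteq> S \<and> card e = 2} \<and> card F = k}"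
  have finS: "finite S" if "S \<in> ?T" for S using that by (auto intro: finite_subset)
  have finU: "finite (?U S)" if "S \<in> ?T" for S
    using finS[OF that] by (auto intro!: finite_subset[of _ "Pow (Pow S)"])
  have finT: "finite ?T" by (rule finite_subset[of _ "Pow {1..n}"]) auto
  show "finite (dense_pairs n k)" unfolding dense_pairs_def using finT finU by (intro finite_SigmaI)
  have cardU: "card (?U S) = (k choose 2) choose k" if "S \<in> ?T" for S
  proof -
    have "finite {e. e \<subseteq> S \<and> card e = 2}"
      using finS[OF that] by (auto intro!: finite_subset[of _ "Pow S"])
    then show ?thesis using n_subsets[of "{e. e \<subseteq> S \<and> card e = 2}" k] n_subsets[OF finS[OF that], of 2] that
      by simp
  qed
  have "card (dense_pairs n k) = (n choose k) * ((k choose 2) choose k)"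
    unfolding dense_pairs_def using finT finU cardU n_subsets[of "{1..n}" k]
    by (simp add: card_SigmaI)
  then have "real (card (dense_pairs n k)) = real (n choose k) * real ((k choose 2) choose k)"
    by simp
  also have "\<dots> \<le> (real n ^ k / fact k) * (real (k choose 2) ^ k / fact k)"
    by (intro mult_mono binomial_le_power_fact) auto
  also have "\<dots> \<le> (real n ^ k / fact k) * ((real k ^ 2) ^ k / fact k)"
  proof -
    have "real (k choose 2) \<le> real k ^ 2 / fact 2" by (rule binomial_le_power_fact)
    also have "\<dots> \<le> real k ^ 2" by simp
    finally show ?thesis by (intro mult_left_mono divide_right_mono power_mono) auto
  qed
  also have "\<dots> = real n ^ k * (real k ^ k / fact k) ^ 2"
    by (simp add: power2_eq_square power_mult_distrib)
  also have "\<dots> \<le> real n ^ k * exp (real k) ^ 2"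
    using power_le_fact_exp[of k] by (intro mult_left_mono power_mono) (auto simp: field_simps)
  also have "exp (real k) ^ 2 = exp 2 ^ k"
    by (simp flip: exp_of_nat_mult add: mult.commute)
  finally show "real (card (dense_pairs n k)) \<le> (real n * exp 2) ^ k"
    by (simp add: power_mult_distrib)
qed

text \<open>
  If sparsity fails for \<open>F\<close>, one takes all vertices of \<open>F\<close> and discards surplus edges until there are
  as many edges as vertices.
\<close>

lemma not_forest_dense_pair:
  assumes E: "E \<subseteq> all_edges n" and "\<not> forest E"
  obtains k S F where "1 \<le> k" "k \<le> n" "(S, F) \<in> dense_pairs n k" "F \<subseteq> E"
proof -
  have "finite E" using E finite_all_edges by (rule finite_subset)
  moreover have "card e = 2" if "e \<in> E" for e using that E by (auto simp: all_edges_def)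
  ultimately obtain F where F: "F \<subseteq> E" "F \<noteq> {}" "card (\<Union>F) \<le> card F"
    using assms(2) by (auto simp: forest_def not_less)
  then obtain F' where F': "F' \<subseteq> F" "card F' = card (\<Union>F)"
    by (meson obtain_subset_with_card_n)
  have U: "\<Union>F \<subseteq> {1..n}" using F E by (auto simp: all_edges_def)
  then have "card (\<Union>F) \<le> n" using card_mono[OF _ U] by simp
  moreover have "1 \<le> card (\<Union>F)"
  proof -
    obtain e where "e \<in> F" "card e = 2" using F E by (auto simp: all_edges_def)
    moreover have "finite (\<Union>F)" using U by (rule finite_subset) simp
    ultimately have "2 \<le> card (\<Union>F)" by (metis Union_upper card_mono)
    then show ?thesis by simp
  qed
  moreover have "(\<Union>F, F') \<in> dense_pairs n (card (\<Union>F))"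
    using U F F' E by (auto simp: dense_pairs_def all_edges_def)
  ultimately show ?thesis using that F F' by blast
qed

text \<open>
  The union bound over all obstructions, grouped by their size \<open>k\<close>.
\<close>

lemma prob_not_forest_le:
  assumes q: "0 \<le> q" "q \<le> 1"
  shows "measure_pmf.prob (erdos_renyi n q) {E. \<not> forest E} \<le> (\<Sum>k=1..n. (real n * q * exp 2) ^ k)"
proof -
  let ?M = "erdos_renyi n q"
  let ?I = "SIGMA k : {1..n}. dense_pairs n k"
  have set: "E \<subseteq> all_edges n" if "E \<in> set_pmf ?M" for E
    using that by (auto simp: erdos_renyi_def)
  have finI: "finite ?I" by (intro finite_SigmaI dense_pairs_finite_card) auto
  have "measure_pmf.prob ?M {E. \<not> forest E} = measure_pmf.prob ?M ({E. \<not> forest E} \<inter> set_pmf ?M)"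
    by (simp add: measure_Int_set_pmf)
  also have "\<dots> \<le> measure_pmf.prob ?M (\<Union>i\<in>?I. {E. snd (snd i) \<subseteq> E})"
  proof (rule measure_pmf.finite_measure_mono)
    show "{E. \<not> forest E} \<inter> set_pmf ?M \<subseteq> (\<Union>i\<in>?I. {E. snd (snd i) \<subseteq> E})"
    proof
      fix E assume "E \<in> {E. \<not> forest E} \<inter> set_pmf ?M"
      then obtain k S F where "1 \<le> k" "k \<le> n" "(S, F) \<in> dense_pairs n k" "F \<subseteq> E"
        using not_forest_dense_pair[of E n] set by blast
      then show "E \<in> (\<Union>i\<in>?I. {E. snd (snd i) \<subseteq> E})"
        by (intro UN_I[of "(k, S, F)"]) auto
    qed
  qed simp
  also have "\<dots> \<le> (\<Sum>i\<in>?I. measure_pmf.prob ?M {E. snd (snd i) \<subseteq> E})"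
    using finI by (intro measure_pmf.finite_measure_subadditive_finite) auto
  also have "\<dots> = (\<Sum>i\<in>?I. q ^ fst i)"
  proof (intro sum.cong refl)
    fix i assume "i \<in> ?I"
    then have "snd (snd i) \<subseteq> all_edges n" "card (snd (snd i)) = fst i"
      by (force simp: dense_pairs_def all_edges_def subset_iff)+
    then show "measure_pmf.prob ?M {E. snd (snd i) \<subseteq> E} = q ^ fst i"
      using prob_contains_edges q by metis
  qed
  also have "\<dots> = (\<Sum>k=1..n. real (card (dense_pairs n k)) * q ^ k)"
    using sum.Sigma[of "{1..n}" "dense_pairs n" "\<lambda>k _. q ^ k"] dense_pairs_finite_card(1)
    by (simp add: case_prod_unfold)
  also have "\<dots> \<le> (\<Sum>k=1..n. (real n * exp 2) ^ k * q ^ k)"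
    using q by (intro sum_mono mult_right_mono dense_pairs_finite_card) auto
  also have "\<dots> = (\<Sum>k=1..n. (real n * q * exp 2) ^ k)"
    by (simp add: power_mult_distrib ac_simps)
  finally show ?thesis .
qed

lemma geometric_sum_le:
  assumes "0 \<le> x" "x < (1::real)"
  shows "(\<Sum>k=1..n. x ^ k) \<le> x / (1 - x)"
proof -
  have "(\<Sum>k=1..n. x ^ k) = x * (\<Sum>k<n. x ^ k)"
    by (simp add: sum_distrib_left sum.atLeast1_atMost_eq)
  also have "\<dots> = x * ((1 - x ^ n) / (1 - x))" using assms by (simp add: sum_gp_strict)
  also have "\<dots> \<le> x * (1 / (1 - x))"
    using assms by (intro mult_left_mono divide_right_mono) auto
  finally show ?thesis by simp
qed

text \<open>
  Squeezed between \<open>1 - x / (1 - x)\<close> and \<open>1\<close>, where \<open>x = n p(n) e\<^sup>2\<close> is the ratio of the geometric series.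
\<close>

theorem theorem5p4:
  fixes p :: "nat \<Rightarrow> real"
  assumes "\<And>n. 0 \<le> p n \<and> p n \<le> 1"
    and "(\<lambda>n. real n * p n) \<longlonglongrightarrow> 0"
  shows "(\<lambda>n. measure_pmf.prob (erdos_renyi n (p n))
            {E. \<forall>k\<ge>1. gamma_vec (sym_edge_polytope E) k = 0}) \<longlonglongrightarrow> 1"
proof (rule real_tendsto_sandwich)
  define x where "x n = real n * p n * exp 2" for n
  have x: "x \<longlonglongrightarrow> 0"
    unfolding x_def using tendsto_mult_right[OF assms(2), of "exp 2"] by simp
  then have "(\<lambda>n. 1 - x n / (1 - x n)) \<longlonglongrightarrow> 1 - 0 / (1 - 0)"
    by (intro tendsto_intros) auto
  then show "(\<lambda>n. 1 - x n / (1 - x n)) \<longlonglongrightarrow> 1" by simp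
  have "eventually (\<lambda>n. x n < 1) sequentially"
    using x by (rule order_tendstoD) simp
  then show "eventually (\<lambda>n. 1 - x n / (1 - x n) \<le> measure_pmf.prob (erdos_renyi n (p n))
            {E. \<forall>k\<ge>1. gamma_vec (sym_edge_polytope E) k = 0}) sequentially"
  proof eventually_elim
    case (elim n)
    let ?M = "erdos_renyi n (p n)"
    have "measure_pmf.prob ?M {E. \<not> forest E} \<le> (\<Sum>k=1..n. x n ^ k)"
      unfolding x_def using assms(1) by (intro prob_not_forest_le) auto
    also have "\<dots> \<le> x n / (1 - x n)"
      using elim assms(1) by (intro geometric_sum_le) (auto simp: x_def)
    finally have "1 - x n / (1 - x n) \<le> 1 - measure_pmf.prob ?M {E. \<not> forest E}" by simp
    also have "\<dots> = measure_pmf.prob ?M {E. forest E}"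
      using measure_pmf.prob_compl[of "{E. \<not> forest E}" ?M] by (simp add: Compl_eq_Diff_UNIV[symmetric] Collect_neg_eq)
    also have "\<dots> \<le> measure_pmf.prob ?M {E. \<forall>k\<ge>1. gamma_vec (sym_edge_polytope E) k = 0}"
      by (intro measure_pmf.finite_measure_mono) (auto simp: forest.gamma_vec_forest)
    finally show ?case .
  qed
qed (auto intro: measure_pmf.prob_le_1)

end
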